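(* For all $x \geq 1$, the central binomial coefficient $\binom{2n}{n}$ is a practical number for all positive integers $n \leq x$ except for at most $O(x^{0.88097})$ of them (with an absolute implied constant).
   Context: A practical number is a positive integer $m$ such that every positive integer less than $m$ can be written as a sum of distinct divisors of $m$. *)

theory Defs
  imports Complex_Main
begin

definition practical :: "nat \<Rightarrow> bool" where
  "practical m \<longleftrightarrow>
     m > 0 \<and> (\<forall>k. 0 < k \<and> k < m \<longrightarrow> (\<exists>D. D \<subseteq> {d. d dvd m} \<and> k = \<Sum>D))"

end

theory Submission
  imports Defs "HOL-Computational_Algebra.Primes"
begin

text \<open>
  If every integer up to the divisor sum of \<open>m\<close> is a sum of distinct divisors of \<open>m\<close>, the same holds
  for \<open>m * q ^ j\<close> whenever \<open>q\<close> is a prime not dividing \<open>m\<close> which exceeds the divisor sum by at most 1.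
  All prime factors of \<open>N = (2 * n) choose n\<close> are at most \<open>2 * n\<close>. So \<open>N\<close> is practical as soon as
  the part of \<open>N\<close> composed of the primes up to 31 is at least \<open>2 * n\<close> and its power of 2 is at least 31.
  Otherwise one of these primes \<open>p\<close> divides \<open>N\<close> to an unusually small power. The multiplicity of \<open>p\<close>
  in \<open>N\<close> is at least the number of base-\<open>p\<close> digits \<open>d\<close> of \<open>n\<close> with \<open>p \<le> 2 * d\<close>, and a large
  deviation bound shows that few \<open>n\<close> have so few of these digits.
\<close>

section \<open>Sums of distinct divisors\<close>

text \<open>The range ends at the divisor sum rather than at \<open>m\<close> as in
  \<open>practical\<close>; in this form the property passes from \<open>m\<close> to
  \<open>m * q ^ j\<close>.\<close>

definition divisor_sums_full :: "nat \<Rightarrow> bool" where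
  "divisor_sums_full m \<longleftrightarrow> (\<forall>k \<le> \<Sum>{d. d dvd m}. \<exists>D \<subseteq> {d. d dvd m}. k = \<Sum>D)"

lemma le_divisor_sum: "m > 0 \<Longrightarrow> m \<le> \<Sum>{d. d dvd m}" for m :: nat
  by (rule member_le_sum[of m "{d. d dvd m}" "\<lambda>d. d"]) auto

lemma divisor_sums_full_imp_practical:
  assumes "divisor_sums_full m" "m > 0"
  shows "practical m"
  using assms le_divisor_sum[of m]
  unfolding practical_def divisor_sums_full_def
  by (meson less_imp_le_nat order_trans)

lemma divisors_times_prime_power_Suc:
  fixes m q :: nat
  assumes "prime q"
  shows "{d. d dvd m * q ^ Suc j} = {d. d dvd m * q ^ j} \<union> (*) (q ^ Suc j) ` {d. d dvd m}"
    (is "?L = ?A \<union> ?B")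
proof
  show "?L \<subseteq> ?A \<union> ?B"
  proof
    fix d assume "d \<in> ?L"
    then obtain b c where bc: "d = b * c" "b dvd m" "c dvd q ^ Suc j"
      using division_decomp by blast
    then obtain i where i: "i \<le> Suc j" "c = q ^ i"
      using divides_primepow_nat[OF assms] by blast
    show "d \<in> ?A \<union> ?B"
    proof (cases "i = Suc j")
      case True
      then show ?thesis using bc i by (auto simp: mult.commute)
    next
      case False
      then have "q ^ i dvd q ^ j" using i by (intro le_imp_power_dvd) auto
      then show ?thesis using bc i by (auto intro: mult_dvd_mono)
    qed
  qed
next
  show "?A \<union> ?B \<subseteq> ?L"
    by (auto simp: mult.commute intro: mult_dvd_mono) (metis dvd_mult2 mult.commute mult.assoc)
qed

lemma divisors_times_prime_power_disjoint:
  fixes m q :: nat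
  assumes "prime q" "\<not> q dvd m"
  shows "{d. d dvd m * q ^ j} \<inter> (*) (q ^ Suc j) ` {d. d dvd m} = {}"
proof -
  have False if "q ^ Suc j * d dvd m * q ^ j" for d
  proof -
    have "q ^ j * q dvd q ^ j * m"
      using that by (metis dvd_mult_left mult.commute power_Suc)
    then show False using assms by (auto simp: prime_gt_0_nat)
  qed
  then show ?thesis by blast
qed

text \<open>Induction on \<open>j\<close>. With \<open>Q = q ^ Suc j\<close>, a target is split as
  \<open>b * Q + r\<close>, where \<open>b\<close> is a sum of divisors of \<open>m\<close> and
  \<open>r\<close> a sum of divisors of \<open>m * q ^ j\<close>. Scaling the former by
  \<open>Q\<close> yields only new divisors, so none is used twice.\<close>

lemma divisor_sums_full_times_prime_power:
  fixes m q :: nat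
  assumes full: "divisor_sums_full m" and m: "m > 0" and q: "prime q" "\<not> q dvd m"
    and le: "q \<le> \<Sum>{d. d dvd m} + 1"
  shows "divisor_sums_full (m * q ^ j)"
proof -
  let ?\<sigma> = "\<lambda>m. \<Sum>{d::nat. d dvd m}"
  have q0: "q > 0" using q prime_gt_0_nat by blast
  \<comment> \<open>The size bound is carried along because it makes every remainder modulo the next
    power of \<open>q\<close> at most the current divisor sum.\<close>
  have "divisor_sums_full (m * q ^ j) \<and> q ^ Suc j \<le> ?\<sigma> (m * q ^ j) + 1"
  proof (induction j)
    case 0
    then show ?case using full le by simp
  next
    case (Suc j)
    let ?Q = "q ^ Suc j"
    let ?A = "{d. d dvd m * q ^ j}" and ?B = "{d. d dvd m}"
    have fin: "finite ?A" "finite ?B" using m q0 by auto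
    have inj: "inj_on ((*) ?Q) X" for X using q0 by (auto simp: inj_on_def)
    have sumB: "\<Sum>((*) ?Q ` X) = ?Q * \<Sum>X" for X
      by (simp only: sum.reindex[OF inj] sum_distrib_left o_def)
    note dv = divisors_times_prime_power_Suc[OF q(1), of m j]
    note dj = divisors_times_prime_power_disjoint[OF q, of j]
    have s: "?\<sigma> (m * q ^ Suc j) = ?\<sigma> (m * q ^ j) + ?Q * ?\<sigma> m"
      unfolding dv by (subst sum.union_disjoint) (use fin dj sumB in auto)
    have Q: "?Q \<le> ?\<sigma> (m * q ^ j) + 1" using Suc by blast
    have "q * ?Q \<le> (?\<sigma> m + 1) * ?Q" using le by (rule mult_right_mono) simp
    also have "\<dots> \<le> ?\<sigma> (m * q ^ Suc j) + 1"
      unfolding s using Q by (simp add: algebra_simps)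
    finally have 1: "q ^ Suc (Suc j) \<le> ?\<sigma> (m * q ^ Suc j) + 1" by simp
    have "\<exists>D \<subseteq> {d. d dvd m * q ^ Suc j}. k = \<Sum>D" if k: "k \<le> ?\<sigma> (m * q ^ Suc j)" for k
    proof -
      \<comment> \<open>The quotient is capped so that \<open>b\<close> stays a sum of divisors of
        \<open>m\<close>; when the cap takes effect, \<open>s\<close> bounds what is left.\<close>
      define b where "b = min (k div ?Q) (?\<sigma> m)"
      have bQ: "b * ?Q \<le> k" unfolding b_def
        by (metis div_times_less_eq_dividend min.cobounded1 mult_le_mono1 order_trans)
      have "k - b * ?Q \<le> ?\<sigma> (m * q ^ j)"
      proof (cases "k div ?Q \<le> ?\<sigma> m")
        case True
        then have "k - b * ?Q = k mod ?Q"
          by (simp add: b_def minus_div_mult_eq_mod)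
        also have "\<dots> < ?Q" using q0 by simp
        finally show ?thesis using Q by linarith
      next
        case False
        then have "b = ?\<sigma> m" by (simp add: b_def)
        then show ?thesis using k s by (simp add: mult.commute)
      qed
      then obtain D1 where D1: "D1 \<subseteq> ?A" "k - b * ?Q = \<Sum>D1"
        using Suc unfolding divisor_sums_full_def by blast
      have "b \<le> ?\<sigma> m" by (simp add: b_def)
      then obtain D2 where D2: "D2 \<subseteq> ?B" "b = \<Sum>D2"
        using full unfolding divisor_sums_full_def by blast
      have f: "finite D1" "finite D2" using D1 D2 fin finite_subset by blast+
      have "\<Sum>(D1 \<union> (*) ?Q ` D2) = \<Sum>D1 + ?Q * b"
        by (subst sum.union_disjoint) (use D1 D2 dj f sumB in auto)
      also have "\<dots> = k" using D1 bQ by (simp add: mult.commute)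
      finally have "k = \<Sum>(D1 \<union> (*) ?Q ` D2)" by simp
      moreover have "D1 \<union> (*) ?Q ` D2 \<subseteq> {d. d dvd m * q ^ Suc j}"
        unfolding dv using D1 D2 by blast
      ultimately show ?thesis by blast
    qed
    then show ?case using 1 unfolding divisor_sums_full_def by blast
  qed
  then show ?thesis by blast
qed

text \<open>The primes of \<open>B\<close> can be added in any order: each is compared only with the
  product over \<open>A\<close>, which divides every later product and hence is at most its divisor
  sum.\<close>

lemma divisor_sums_full_prod_primes:
  fixes f :: "nat \<Rightarrow> nat"
  assumes "finite B" "finite A" "\<And>q. q \<in> A \<union> B \<Longrightarrow> prime q"
    and "\<And>q. q \<in> B \<Longrightarrow> q \<le> (\<Prod>p\<in>A. p ^ f p) + 1"
    and "divisor_sums_full (\<Prod>p\<in>A. p ^ f p)"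
  shows "divisor_sums_full (\<Prod>p\<in>A \<union> B. p ^ f p)"
  using assms
proof (induction B rule: finite_induct)
  case empty
  then show ?case by simp
next
  case (insert q B)
  let ?m = "\<Prod>p\<in>A \<union> B. p ^ f p"
  have IH: "divisor_sums_full ?m" using insert by blast
  show ?case
  proof (cases "q \<in> A")
    case True
    then have "A \<union> insert q B = A \<union> B" by blast
    then show ?thesis using IH by simp
  next
    case False
    have pos: "?m > 0" using insert.prems by (intro prod_pos) (auto simp: prime_gt_0_nat)
    have "\<not> q dvd ?m"
    proof
      assume "q dvd ?m"
      then obtain p where "p \<in> A \<union> B" "q dvd p ^ f p"
        using insert by (auto simp: prime_dvd_prod_iff)
      then show False
        using insert False by (metis UnE Un_insert_right insertI1 insertI2 primes_dvd_imp_eq prime_dvd_power)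
    qed
    moreover have "(\<Prod>p\<in>A. p ^ f p) \<le> ?m"
    proof (rule dvd_imp_le[OF _ pos])
      show "(\<Prod>p\<in>A. p ^ f p) dvd ?m"
        using insert by (intro prod_dvd_prod_subset) auto
    qed
    then have "q \<le> \<Sum>{d. d dvd ?m} + 1"
      using le_divisor_sum[OF pos] insert.prems(3)[of q] by simp
    moreover have "prime q" using insert by blast
    ultimately have "divisor_sums_full (?m * q ^ f q)"
      using divisor_sums_full_times_prime_power[OF IH pos] by blast
    moreover have "(\<Prod>p\<in>A \<union> insert q B. p ^ f p) = ?m * q ^ f q"
      using insert False by (simp add: mult.commute)
    ultimately show ?thesis by simp
  qed
qed

text \<open>Three stages: 2 can be added to the empty product because 2 = 1 + 1, the power of 2 then
  admits the rest of \<open>S\<close>, and the part of \<open>N\<close> over \<open>S\<close> admits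
  all remaining prime factors.\<close>

lemma practical_if_prime_powers_large:
  fixes N :: nat and S :: "nat set"
  assumes N: "N > 0" and S: "finite S" "\<And>q. q \<in> S \<Longrightarrow> prime q" "2 \<in> S"
    and two: "\<And>q. q \<in> S \<Longrightarrow> q \<le> 2 ^ multiplicity 2 N"
    and rest: "\<And>q. prime q \<Longrightarrow> q dvd N \<Longrightarrow> q \<le> (\<Prod>p\<in>S. p ^ multiplicity p N)"
  shows "practical N"
proof -
  let ?f = "\<lambda>p. multiplicity p N"
  have "\<exists>D \<subseteq> {1}. k = \<Sum>D" if "k \<le> 1" for k :: nat
  proof (cases "k = 0")
    case True
    then show ?thesis by (intro exI[of _ "{}"]) simp
  next
    case False
    then show ?thesis using that by (intro exI[of _ "{1}"]) simp
  qed
  then have "divisor_sums_full 1"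
    unfolding divisor_sums_full_def by simp
  then have "divisor_sums_full (\<Prod>p\<in>{} \<union> {2}. p ^ ?f p)"
    by (intro divisor_sums_full_prod_primes) auto
  then have "divisor_sums_full (\<Prod>p\<in>{2} \<union> S. p ^ ?f p)"
    using S two by (intro divisor_sums_full_prod_primes) (auto intro: le_SucI)
  then have "divisor_sums_full (\<Prod>p\<in>S. p ^ ?f p)"
    using S by (simp add: insert_absorb)
  then have "divisor_sums_full (\<Prod>p\<in>S \<union> prime_factors N. p ^ ?f p)"
    using S rest by (intro divisor_sums_full_prod_primes) (auto intro: le_SucI)
  moreover have "(\<Prod>p\<in>S \<union> prime_factors N. p ^ ?f p) = (\<Prod>p\<in>prime_factors N. p ^ ?f p)"
    by (rule prod.mono_neutral_right)
      (use S in \<open>auto simp: in_prime_factors_iff not_dvd_imp_multiplicity_0\<close>)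
  ultimately show ?thesis
    using divisor_sums_full_imp_practical N prime_factorization_nat[OF N] by metis
qed

section \<open>Prime powers in central binomial coefficients\<close>

text \<open>One step of Legendre's formula: only the \<open>n div p\<close> multiples of
  \<open>p\<close> contribute, and taking one factor \<open>p\<close> out of each leaves
  \<open>fact (n div p)\<close>.\<close>

lemma multiplicity_fact_div:
  fixes p :: nat
  assumes "prime p"
  shows "multiplicity p (fact n :: nat) = n div p + multiplicity p (fact (n div p) :: nat)"
proof (induction n)
  case 0
  then show ?case by simp
next
  case (Suc n)
  have p: "prime_elem p" "p > 0" "\<not> is_unit p"
    using assms prime_gt_0_nat not_prime_1 by auto
  have split: "multiplicity p (fact (Suc k) :: nat) = multiplicity p (Suc k) + multiplicity p (fact k :: nat)" for k
    by (simp only: fact_Suc of_nat_id) (rule prime_elem_multiplicity_mult_distrib[OF p(1)], auto)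
  show ?case
  proof (cases "p dvd Suc n")
    case True
    then have d: "Suc n div p = Suc (n div p)" using div_Suc[of n p] by (simp add: dvd_eq_mod_eq_0)
    have "Suc n = p * Suc (n div p)" using True d by (metis dvd_mult_div_cancel)
    then have "multiplicity p (Suc n) = Suc (multiplicity p (Suc (n div p)))"
      using p by (metis multiplicity_times_same nat.distinct(1) not_gr_zero)
    then show ?thesis using Suc split[of n] split[of "n div p"] d by simp
  next
    case False
    then have "Suc n div p = n div p" using div_Suc[of n p] by (simp add: dvd_eq_mod_eq_0)
    then show ?thesis using Suc split[of n] False by (simp add: not_dvd_imp_multiplicity_0)
  qed
qed

text \<open>
  Among the last \<open>L\<close> base-\<open>p\<close> digits of \<open>n\<close>, those which produce a carry in the addition
  \<open>n + n\<close> whatever happens to their right. Kummer's theorem would count all carries; these ones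
  suffice, and they have independent digits.
\<close>
primrec large_digits :: "nat \<Rightarrow> nat \<Rightarrow> nat \<Rightarrow> nat" where
  "large_digits p 0 n = 0"
| "large_digits p (Suc L) n = of_bool (p \<le> 2 * (n mod p)) + large_digits p L (n div p)"

lemma multiplicity_central_binomial:
  fixes p :: nat
  assumes "prime p"
  shows "multiplicity p ((2 * n) choose n) + 2 * multiplicity p (fact n :: nat)
    = multiplicity p (fact (2 * n) :: nat)"
proof -
  have "fact n * fact n * ((2 * n) choose n) = (fact (2 * n) :: nat)"
    using binomial_fact_lemma[of n "2 * n"] by simp
  moreover have "prime_elem p" using assms by simp
  ultimately show ?thesis
    using prime_elem_multiplicity_mult_distrib[of p "fact n * fact n" "(2 * n) choose n"]
      prime_elem_multiplicity_mult_distrib[of p "fact n" "fact n :: nat"]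
    by simp
qed

text \<open>The last digit is peeled off: for \<open>n = p * m + r\<close>, Legendre's step turns
  the carry \<open>e\<close> out of \<open>r\<close> into a factor \<open>p\<close>, and the rest is
  compared with the binomial coefficient of \<open>m\<close>.\<close>

lemma large_digits_le_multiplicity:
  fixes p :: nat
  assumes "prime p"
  shows "large_digits p L n \<le> multiplicity p ((2 * n) choose n)"
proof (induction L arbitrary: n)
  case 0
  then show ?case by simp
next
  case (Suc L)
  define m r e where "m = n div p" and "r = n mod p" and "e = (of_bool (p \<le> 2 * r) :: nat)"
  have p: "p > 0" using assms prime_gt_0_nat by blast
  have "r < p" using p by (simp add: r_def)
  have "2 * n = 2 * r + p * (2 * m)"
    unfolding m_def r_def by (metis add.commute distrib_left mult.left_commute mult_div_mod_eq)
  then have "2 * n div p = 2 * m + 2 * r div p" using p by simp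
  also have "2 * r div p = e"
    unfolding e_def using \<open>r < p\<close> p by (auto simp: div_if)
  finally have d: "2 * n div p = 2 * m + e" .
  \<comment> \<open>The only loss: the effect of the carry \<open>e\<close> on the higher digits is
    discarded.\<close>
  have "multiplicity p (fact (2 * m) :: nat) \<le> multiplicity p (fact (2 * m + e) :: nat)"
    by (rule dvd_imp_multiplicity_le) (auto intro: fact_dvd)
  moreover have "multiplicity p (fact (2 * n) :: nat) = 2 * m + e + multiplicity p (fact (2 * m + e) :: nat)"
    using multiplicity_fact_div[OF assms, of "2 * n"] d by simp
  moreover have "multiplicity p (fact n :: nat) = m + multiplicity p (fact m :: nat)"
    using multiplicity_fact_div[OF assms, of n] by (simp add: m_def)
  ultimately have "e + multiplicity p ((2 * m) choose m) \<le> multiplicity p ((2 * n) choose n)"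
    using multiplicity_central_binomial[OF assms, of n] multiplicity_central_binomial[OF assms, of m]
    by linarith
  then show ?case using Suc[of m] by (simp add: e_def r_def m_def)
qed

text \<open>The digits range independently over all values, so the generating function is a product
  over positions. At each, \<open>p div 2\<close> digits are large and \<open>(p + 1) div 2\<close>
  are not.\<close>

lemma sum_power_large_digits:
  fixes z :: "'a :: comm_semiring_1"
  assumes p: "p > 0"
  shows "(\<Sum>n<p ^ L. z ^ large_digits p L n) = (of_nat ((p + 1) div 2) + of_nat (p div 2) * z) ^ L"
proof (induction L)
  case 0
  then show ?case by simp
next
  case (Suc L)
  let ?g = "\<lambda>r. z ^ of_bool (p \<le> 2 * r)"
  have split: "{..<p} = {..<(p + 1) div 2} \<union> {(p + 1) div 2..<p}" by auto
  have s: "(\<Sum>r<p. ?g r) = of_nat ((p + 1) div 2) + of_nat (p div 2) * z"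
  proof -
    have "(\<Sum>r<p. ?g r) = (\<Sum>r<(p + 1) div 2. ?g r) + (\<Sum>r=(p + 1) div 2..<p. ?g r)"
      unfolding split by (rule sum.union_disjoint) auto
    also have "(\<Sum>r<(p + 1) div 2. ?g r) = (\<Sum>r<(p + 1) div 2. 1)"
      by (rule sum.cong) auto
    also have "(\<Sum>r=(p + 1) div 2..<p. ?g r) = (\<Sum>r=(p + 1) div 2..<p. z)"
      by (rule sum.cong) auto
    also have "p - (p + 1) div 2 = p div 2" by linarith
    then have "(\<Sum>r=(p + 1) div 2..<p. z) = of_nat (p div 2) * z" by simp
    finally show ?thesis by simp
  qed
  have shift: "(\<Sum>n = k..<k + p. h n) = (\<Sum>r<p. h (r + k))" for h :: "nat \<Rightarrow> 'a" and k
    using sum.shift_bounds_nat_ivl[of h 0 k p] by (simp add: lessThan_atLeast0 add.commute)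
  have "(\<Sum>n<p ^ Suc L. z ^ large_digits p (Suc L) n)
      = (\<Sum>m<p ^ L. \<Sum>n\<in>{m * p..<m * p + p}. z ^ large_digits p (Suc L) n)"
    using sum.nat_group[of "\<lambda>n. z ^ large_digits p (Suc L) n" p "p ^ L"] by (simp add: mult.commute)
  also have "\<dots> = (\<Sum>m<p ^ L. \<Sum>r<p. z ^ large_digits p (Suc L) (r + m * p))"
    by (simp only: shift)
  also have "\<dots> = (\<Sum>m<p ^ L. \<Sum>r<p. ?g r * z ^ large_digits p L m)"
    using p by (intro sum.cong) (auto simp: power_add)
  also have "\<dots> = (\<Sum>r<p. ?g r) * (\<Sum>m<p ^ L. z ^ large_digits p L m)"
    unfolding sum_product by (rule sum.swap)
  finally show ?case using Suc s by simp
qed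

text \<open>
  A Chernoff bound: \<open>n\<close> is weighted by \<open>z ^ large_digits p L n\<close>, with \<open>p ^ L\<close> just above \<open>x\<close>.
\<close>
lemma card_central_binomial_small_prime_power:
  fixes p :: nat and w \<theta> z :: real
  assumes p: "prime p" and z: "0 < z" "z \<le> 1"
    and le: "real ((p + 1) div 2) + real (p div 2) * z \<le> p powr \<theta> * z powr w"
  shows "\<exists>K>0. \<forall>x\<ge>1. real (card {n. real n \<le> x \<and>
      real p ^ multiplicity p ((2 * n) choose n) < (2 * x) powr w}) \<le> K * x powr \<theta>"
proof -
  define A where "A = real ((p + 1) div 2) + real (p div 2) * z"
  \<comment> \<open>The factor \<open>A\<close> pays for rounding \<open>log p x\<close> up to
    \<open>L\<close>, the power of \<open>z\<close> for the 2 in \<open>2 * x\<close>.\<close>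
  define K where "K = A * z powr (- (w * log p 2))"
  have p2: "p \<ge> 2" using p prime_ge_2_nat by blast
  then have "(p + 1) div 2 \<ge> 1" by simp
  then have "A \<ge> 1" unfolding A_def using z
    by (metis add_increasing2 mult_nonneg_nonneg of_nat_0_le_iff of_nat_1 of_nat_le_iff less_imp_le)
  then have K: "K > 0" using z by (simp add: K_def)
  have "real (card {n. real n \<le> x \<and> real p ^ multiplicity p ((2 * n) choose n) < (2 * x) powr w})
      \<le> K * x powr \<theta>" (is "real (card ?S) \<le> _") if x: "x \<ge> 1" for x
  proof -
    define L where "L = nat \<lfloor>log p x\<rfloor> + 1"
    define u where "u = w * log p (2 * x)"
    have "log p x \<ge> 0" using x p2 by simp
    then have L: "log p x < L" "L \<le> log p x + 1" unfolding L_def by linarith+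
    have sub: "?S \<subseteq> {..<p ^ L}"
    proof
      fix n assume "n \<in> ?S"
      then have "real n \<le> p powr (log p x)" using x p2 by simp
      also have "\<dots> < p powr L" using L p2 by (intro powr_less_mono) auto
      also have "\<dots> = real (p ^ L)" using p2 by (simp add: powr_realpow)
      finally have "n < p ^ L" by (simp only: of_nat_less_iff)
      then show "n \<in> {..<p ^ L}" by simp
    qed
    \<comment> \<open>Since \<open>p powr u\<close> equals \<open>(2 * x) powr w\<close>, such an
      \<open>n\<close> has at most \<open>u\<close> large digits; as \<open>z \<le> 1\<close>, its
      weight is at least \<open>z powr u\<close>.\<close>
    have one: "1 \<le> z ^ large_digits p L n * z powr (- u)" if "n \<in> ?S" for n
    proof -
      let ?l = "large_digits p L n"
      have "p powr ?l = real p ^ ?l" using p2 by (simp add: powr_realpow)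
      also have "\<dots> \<le> real p ^ multiplicity p ((2 * n) choose n)"
        using large_digits_le_multiplicity[OF p] p2 by (intro power_increasing) auto
      also have "\<dots> < (2 * x) powr w" using that by simp
      also have "\<dots> = p powr u" using x p2 by (simp add: u_def powr_powr[symmetric] mult.commute[of w])
      finally have "?l \<le> u" using p2 by simp
      then have "z powr u \<le> z powr ?l" using z by (intro powr_mono') auto
      then show ?thesis using z by (simp add: powr_minus divide_simps powr_realpow)
    qed
    have "real (card ?S) = (\<Sum>n\<in>?S. 1)" by simp
    also have "\<dots> \<le> (\<Sum>n\<in>?S. z ^ large_digits p L n * z powr (- u))"
      by (rule sum_mono) (rule one)
    also have "\<dots> \<le> (\<Sum>n<p ^ L. z ^ large_digits p L n * z powr (- u))"
      using sub z by (intro sum_mono2) auto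
    also have "\<dots> = A ^ L * z powr (- u)"
      using sum_power_large_digits[of p z L] p2 by (simp add: A_def sum_distrib_right[symmetric])
    also have "A ^ L = A powr L" using \<open>A \<ge> 1\<close> by (simp add: powr_realpow)
    also have "\<dots> \<le> A powr (log p x + 1)" using L \<open>A \<ge> 1\<close> by (intro powr_mono) auto
    also have "\<dots> = A powr log p x * A" using \<open>A \<ge> 1\<close> by (simp add: powr_add)
    also have "z powr (- u) = z powr (- (w * log p 2)) * z powr (- (w * log p x))"
      using x p2 by (simp add: u_def log_mult powr_add[symmetric] algebra_simps)
    finally have "real (card ?S) \<le> K * (A powr log p x * z powr (- (w * log p x)))"
      using z by (simp add: K_def mult_ac)
    \<comment> \<open>This is \<open>le\<close> raised to the power \<open>log p x\<close>, using
      that \<open>p powr log p x\<close> is \<open>x\<close>.\<close>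
    also have "A powr log p x * z powr (- (w * log p x)) \<le> x powr \<theta>"
    proof -
      have "A powr log p x \<le> (p powr \<theta> * z powr w) powr log p x"
        using le \<open>A \<ge> 1\<close> \<open>log p x \<ge> 0\<close> unfolding A_def by (intro powr_mono2) auto
      also have "\<dots> = (p powr log p x) powr \<theta> * z powr (w * log p x)"
        by (simp add: powr_mult powr_powr mult.commute)
      also have "p powr log p x = x" using x p2 by simp
      finally show ?thesis using z by (simp add: powr_minus divide_simps)
    qed
    finally show ?thesis using K by simp
  qed
  then show ?thesis using K by blast
qed

section \<open>The choice of primes and exponents\<close>

definition small_primes :: "nat set" where
  "small_primes = {2, 3, 5, 7, 11, 13, 17, 19, 23, 29, 31}"

text \<open>
  A prime power \<open>p ^ v\<close> counts as small if it is below \<open>(2 * x) powr (weight p / 25)\<close>; the Chernoff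
  bound is applied with \<open>z = 1 / tilt p\<close>. The values are chosen so that the weights add up to 25
  while the bound still gives the exponent \<open>22 / 25 < 0.88097\<close> for each prime.
\<close>
definition weight :: "nat \<Rightarrow> nat" where
  "weight p = (if p = 2 then 7 else if p < 29 then 2 else 1)"

definition tilt :: "nat \<Rightarrow> nat" where
  "tilt p = (if p = 2 then 2 else 10)"

lemma small_primes_prime: "p \<in> small_primes \<Longrightarrow> prime p"
  by (auto simp: small_primes_def)

lemma finite_small_primes: "finite small_primes"
  by (simp add: small_primes_def)

lemma sum_weight: "(\<Sum>p\<in>small_primes. weight p) = 25"
  by (simp add: small_primes_def weight_def)

text \<open>The Chernoff condition for \<open>z = 1 / tilt p\<close>, raised to the power 25 and
  cleared of denominators: an integer inequality checked prime by prime.\<close>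

lemma weight_tilt:
  assumes "p \<in> small_primes"
  shows "((p + 1) div 2 * tilt p + p div 2) ^ 25 * tilt p ^ weight p \<le> p ^ 22 * tilt p ^ 25"
  using assms unfolding small_primes_def
  by (elim insertE emptyE) (simp_all add: weight_def tilt_def)

lemma small_prime_exponent:
  assumes "p \<in> small_primes"
  shows "real ((p + 1) div 2) + real (p div 2) * (1 / tilt p)
    \<le> real p powr (22 / 25) * (1 / tilt p) powr (weight p / 25)"
proof -
  define a b c e where "a = real ((p + 1) div 2)" and "b = real (p div 2)"
    and "c = real (tilt p)" and "e = weight p"
  have c: "c > 0" using assms by (auto simp: c_def tilt_def small_primes_def)
  have p: "real p > 0" using small_primes_prime[OF assms] prime_gt_0_nat by simp
  have "(a * c + b) ^ 25 * c ^ e \<le> real p ^ 22 * c ^ 25"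
    using weight_tilt[OF assms] unfolding a_def b_def c_def e_def
    by (metis (mono_tags, lifting) of_nat_add of_nat_le_iff of_nat_mult of_nat_power)
  then have "((a * c + b) / c) ^ 25 \<le> real p ^ 22 / c ^ e"
    using c by (simp add: field_simps power_divide)
  also have "\<dots> = (real p powr (22 / 25) * (1 / c) powr (e / 25)) ^ 25"
    using c p by (simp add: power_mult_distrib powr_power powr_realpow powr_divide power_divide)
  \<comment> \<open>Taking 25th roots; the rule is stated for exponent \<open>Suc n\<close>, hence
    24.\<close>
  finally have "(a * c + b) / c \<le> real p powr (22 / 25) * (1 / c) powr (e / 25)"
    by (rule power_le_imp_le_base[of _ 24, simplified]) auto
  then show ?thesis using c by (simp add: a_def b_def c_def e_def field_simps)
qed

lemma practical_central_binomial:
  fixes n :: nat and x :: real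
  assumes n: "n > 0" "real n \<le> x" and x: "x \<ge> 500000"
    and large: "\<And>p. p \<in> small_primes \<Longrightarrow>
      (2 * x) powr (weight p / 25) \<le> real p ^ multiplicity p ((2 * n) choose n)"
  shows "practical ((2 * n) choose n)"
proof (rule practical_if_prime_powers_large[of _ small_primes])
  let ?N = "(2 * n) choose n"
  show "?N > 0" by simp
  show "finite small_primes" by (rule finite_small_primes)
  show "2 \<in> small_primes" by (simp add: small_primes_def)
  show "prime q" if "q \<in> small_primes" for q by (rule small_primes_prime[OF that])
  show "q \<le> 2 ^ multiplicity 2 ?N" if "q \<in> small_primes" for q
  proof -
    have "real q \<le> 31" using that by (auto simp: small_primes_def)
    \<comment> \<open>The threshold on \<open>x\<close> comes from here:
      \<open>31 ^ 4 = 923521\<close> is below \<open>2 * 500000\<close>, and 1/4 is below the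
      exponent 7/25 assigned to the prime 2.\<close>
    also have "31 = (31 ^ 4 :: real) powr (1 / 4)" by (simp add: powr_powr flip: powr_numeral)
    also have "\<dots> \<le> (2 * x) powr (1 / 4)" using x by (intro powr_mono2) auto
    also have "\<dots> \<le> (2 * x) powr (7 / 25)" using x by (intro powr_mono) auto
    also have "\<dots> \<le> real 2 ^ multiplicity 2 ?N"
      using large[of 2] by (simp add: small_primes_def weight_def)
    finally show ?thesis by (metis of_nat_le_iff of_nat_power)
  qed
  show "q \<le> (\<Prod>p\<in>small_primes. p ^ multiplicity p ?N)" if "prime q" "q dvd ?N" for q
  proof -
    have "q dvd fact (2 * n)"
      using that binomial_fact_lemma[of n "2 * n"] by (metis dvd_mult le_add1 mult_2)
    then have "q \<le> 2 * n" using that prime_dvd_fact_iff by blast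
    then have "real q \<le> 2 * x" using n by linarith
    \<comment> \<open>The weights add up to 25, so these exponents add up to 1.\<close>
    also have "2 * x = (2 * x) powr (\<Sum>p\<in>small_primes. weight p / 25)"
      using x sum_weight by (simp flip: sum_divide_distrib of_nat_sum)
    also have "\<dots> = (\<Prod>p\<in>small_primes. (2 * x) powr (weight p / 25))"
      using x finite_small_primes by (intro powr_sum) auto
    also have "\<dots> \<le> (\<Prod>p\<in>small_primes. real p ^ multiplicity p ?N)"
      using large by (intro prod_mono) auto
    also have "\<dots> = real (\<Prod>p\<in>small_primes. p ^ multiplicity p ?N)" by simp
    finally show ?thesis by (simp only: of_nat_le_iff)
  qed
qed

theorem theorem1p3:
  shows "\<exists>C::real. C > 0 \<and> (\<forall>x::real. x \<ge> 1 \<longrightarrow>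
           real (card {n::nat. 0 < n \<and> real n \<le> x \<and> \<not> practical ((2 * n) choose n)})
             \<le> C * x powr 0.88097)"
proof -
  define T where "T p x = {n. real n \<le> x \<and>
      real p ^ multiplicity p ((2 * n) choose n) < (2 * x) powr (weight p / 25)}" for p and x :: real
  have "\<forall>p\<in>small_primes. \<exists>K>0. \<forall>x\<ge>1. real (card (T p x)) \<le> K * x powr (22 / 25)"
    unfolding T_def
  proof
    fix p assume p: "p \<in> small_primes"
    then have "tilt p \<ge> 1" by (auto simp: tilt_def small_primes_def)
    then show "\<exists>K>0. \<forall>x\<ge>1. real (card {n. real n \<le> x \<and>
      real p ^ multiplicity p ((2 * n) choose n) < (2 * x) powr (weight p / 25)}) \<le> K * x powr (22 / 25)"
      by (intro card_central_binomial_small_prime_power[where z = "1 / tilt p"]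
          small_primes_prime small_prime_exponent p) auto
  qed
  then obtain K where K: "\<And>p. p \<in> small_primes \<Longrightarrow> K p > 0"
    "\<And>p x. p \<in> small_primes \<Longrightarrow> x \<ge> 1 \<Longrightarrow> real (card (T p x)) \<le> K p * x powr (22 / 25)"
    by metis
  \<comment> \<open>The first summand covers \<open>x < 500000\<close> by the trivial count, the
    second the union bound over the small primes.\<close>
  define C where "C = 500000 + (\<Sum>p\<in>small_primes. K p)"
  have "(\<Sum>p\<in>small_primes. K p) \<ge> 0" using K by (intro sum_nonneg) (simp add: less_imp_le)
  then have C: "C \<ge> 500000" "C \<ge> (\<Sum>p\<in>small_primes. K p)" by (auto simp: C_def)
  have "real (card {n. 0 < n \<and> real n \<le> x \<and> \<not> practical ((2 * n) choose n)}) \<le> C * x powr 0.88097"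
    (is "real (card ?B) \<le> _") if x: "x \<ge> 1" for x
  proof (cases "x \<ge> 500000")
    case True
    have fin: "finite (T p x)" for p
      by (rule finite_subset[of _ "{..nat \<lfloor>x\<rfloor>}"]) (auto simp: T_def le_nat_iff le_floor_iff)
    \<comment> \<open>Contrapositive of \<open>practical_central_binomial\<close>: some small prime
      must have too small a power.\<close>
    have "?B \<subseteq> (\<Union>p\<in>small_primes. T p x)"
      using practical_central_binomial[OF _ _ True] by (auto simp: T_def not_le) (meson not_le)
    then have "card ?B \<le> card (\<Union>p\<in>small_primes. T p x)"
      using fin finite_small_primes by (intro card_mono) auto
    also have "\<dots> \<le> (\<Sum>p\<in>small_primes. card (T p x))"
      by (rule card_UN_le[OF finite_small_primes])
    finally have "real (card ?B) \<le> (\<Sum>p\<in>small_primes. real (card (T p x)))"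
      unfolding of_nat_sum[symmetric] of_nat_le_iff .
    also have "\<dots> \<le> (\<Sum>p\<in>small_primes. K p * x powr (22 / 25))"
      using K x by (intro sum_mono) auto
    also have "\<dots> = (\<Sum>p\<in>small_primes. K p) * x powr (22 / 25)"
      by (simp add: sum_distrib_right)
    also have "\<dots> \<le> C * x powr 0.88097"
      using C x by (intro mult_mono powr_mono) auto
    finally show ?thesis .
  next
    case False
    have "?B \<subseteq> {1..nat \<lfloor>x\<rfloor>}" by (auto simp: le_nat_iff le_floor_iff)
    then have "card ?B \<le> nat \<lfloor>x\<rfloor>" using card_mono[of "{1..nat \<lfloor>x\<rfloor>}" ?B] by simp
    then have "real (card ?B) \<le> C" using False C x by linarith
    also have "\<dots> \<le> C * x powr 0.88097" using C x by (simp add: ge_one_powr_ge_zero)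
    finally show ?thesis .
  qed
  moreover have "C > 0" using C by simp
  ultimately show ?thesis by blast
qed

end
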